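(* Let $\mathcal{Q}$ be a nonempty finite set of positive integers with largest element $q$, let $a=|\mathbb{N}_q-\mathcal{Q}|$, and let $p_1<p_2<\cdots<p_a$ be the elements of $\mathbb{N}_q-\mathcal{Q}$ (with $a\ge1$). If $p_1=l$, $p_a=q-r$, $l>r$ and either (i) $q=2l$ or (ii) $a=2$, $q\ge2l$, but $q\ne2l+r$, then for all integers $n$ and $k$, $$\begin{aligned}B_{n,k}&=\delta_{n,0}\delta_{k,0}+B_{n-1,k}+B_{n-2l-1,k-1}+B_{n-3l-1,k-2}\\&\qquad+\sum_{i=2}^a\left(B_{n-p_i,k-1}-B_{n-p_i-1,k-1}+B_{n-l-p_i,k-2}-B_{n-l-p_i-1,k-2}-\delta_{n,p_i}\delta_{k,1}-\delta_{n,l+p_i}\delta_{k,2}\right).\end{aligned}$$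
   Context: $\mathbb{N}_q=\{1,2,\ldots,q\}$; $\delta_{i,j}$ is $1$ if $i=j$ and $0$ otherwise. An $N$-board is a linear array of $N$ unit square cells, numbered $1,\ldots,N$ from left to right. A square is a $1\times1$ tile. The comb corresponding to $\mathcal{Q}$ (where $q=\max\mathcal{Q}$) is a tile of length $q+1$ with cells numbered $0,1,\ldots,q$ from left to right, in which cell $0$ is filled and cell $i$ ($1\le i\le q$) is filled if and only if $i\in\mathcal{Q}$; unfilled cells are gaps and are not part of the tile. The number $r$ is the width of the rightmost run of consecutive filled cells (the final tooth) of the comb, and $l$ is the width of the leftmost such run. A restricted-overlap tiling of a board is a placement of tiles on the board (each tile lying entirely within the board) such that every cell of the board is covered by a filled cell of at least one tile, and the leftmost cell of each tile is not covered by any other tile; filled cells that are not the leftmost cells of their tiles are allowed to overlap one another. A tiling is determined by which tiles are placed at which positions. $B_{n,k}$ is the number of restricted-overlap tilings of an $n$-board using squares and exactly $k$ combs corresponding to $\mathcal{Q}$. By convention $B_{0,0}=1$ and $B_{n,k}=0$ if $n<0$, $k<0$ or $n<k$.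
   Formalization: The terms B_{n-2l-1,k-1} and B_{n-3l-1,k-2} are replaced by B_{n-q-1,k-1} and B_{n-l-q-1,k-2}; these agree when q=2l, and the printed formula is false in case (ii) whenever q>2l (e.g. Q={1,3,4,6}, n=5, k=1: left side 0, right side 1). *)

theory Defs
  imports Main
begin

definition comb :: "nat set \<Rightarrow> nat set" where
  "comb Q = insert 0 Q"

text \<open>The comb has length \<open>Max Q + 1\<close>, with cells numbered \<open>0, \<dots>, Max Q\<close>. The width of a run at
  either end is the number of cells in the longest block of filled cells at that end.\<close>

definition first_tooth_width :: "nat set \<Rightarrow> nat" where
  "first_tooth_width Q = Max {w. w \<le> Max Q + 1 \<and> {0..<w} \<subseteq> comb Q}"

definition final_tooth_width :: "nat set \<Rightarrow> nat" where
  "final_tooth_width Q = Max {w. w \<le> Max Q + 1 \<and> {Max Q + 1 - w..<Max Q + 1} \<subseteq> comb Q}"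

datatype tile = Square | Comb

text \<open>A placed tile is a pair of a tile and the board cell of its leftmost cell. A tiling is
  determined by the tiles used and their positions, so it is a set of placed tiles.\<close>

type_synonym placed_tile = "tile \<times> nat"

fun covered :: "nat set \<Rightarrow> placed_tile \<Rightarrow> nat set" where
  "covered Q (Square, x) = {x}"
| "covered Q (Comb, x) = (\<lambda>i. x + i) ` comb Q"

text \<open>Both end cells of each tile are filled, so a tile lies within the board if and only if its
  filled cells do.\<close>

definition restricted_overlap_tiling :: "nat set \<Rightarrow> nat \<Rightarrow> placed_tile set \<Rightarrow> bool" where
  "restricted_overlap_tiling Q N T \<longleftrightarrow>
     (\<forall>t\<in>T. covered Q t \<subseteq> {1..N}) \<and>
     {1..N} \<subseteq> (\<Union>t\<in>T. covered Q t) \<and>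
     (\<forall>t\<in>T. \<forall>t'\<in>T. t' \<noteq> t \<longrightarrow> snd t \<notin> covered Q t')"

definition B :: "nat set \<Rightarrow> int \<Rightarrow> int \<Rightarrow> int" where
  "B Q n k =
     (if n < 0 \<or> k < 0 \<or> n < k then 0
      else int (card {T. restricted_overlap_tiling Q (nat n) T \<and>
                         card {t \<in> T. fst t = Comb} = nat k}))"

definition kdelta :: "int \<Rightarrow> int \<Rightarrow> int" where
  "kdelta i j = (if i = j then 1 else 0)"

end

theory Submission
  imports Defs
begin

text \<open>In a restricted-overlap tiling the squares sit exactly on the cells not covered by combs, so a
  tiling is determined by the set of comb positions, which can be any subset of \<open>{1..n - q}\<close> in
  which no two elements differ by an element of \<open>Q\<close>. Under the hypotheses, such sets are described
  by their gaps between consecutive elements: each gap is some \<open>p\<^sub>i\<close> or exceeds \<open>q\<close>, and the only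
  other restriction is that two consecutive gaps are not both \<open>l\<close>, since \<open>2l \<in> Q\<close> while any other
  two gaps add up to more than \<open>q\<close>. The recursion arises from removing the largest element.\<close>

section \<open>Tilings as difference-avoiding sets of comb positions\<close>

text \<open>Bounds and positions are integers so that a shift such as \<open>j - x\<close> is never
  truncated; for \<open>j\<close> below 1 the only candidate is the empty set. Each difference is
  tested with both signs, and a negative one is never the image of an element of
  \<open>Q\<close>.\<close>

definition difference_avoiding :: "nat set \<Rightarrow> int \<Rightarrow> int \<Rightarrow> int set set" where
  "difference_avoiding Q j k =
     {C. C \<subseteq> {1..j} \<and> int (card C) = k \<and> (\<forall>x\<in>C. \<forall>y\<in>C. y - x \<notin> int ` Q)}"

text \<open>The squares are forced: a cell that no comb covers needs one, and a square on a cell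
  that a comb covers would have its leftmost cell covered by another tile.\<close>

definition tiling_of :: "nat set \<Rightarrow> nat \<Rightarrow> int set \<Rightarrow> placed_tile set" where
  "tiling_of Q N C =
     (\<lambda>x. (Comb, nat x)) ` C \<union> Pair Square ` ({1..N} - (\<Union>x\<in>C. covered Q (Comb, nat x)))"

lemma finite_difference_avoiding: "finite (difference_avoiding Q j k)"
  by (rule finite_subset[of _ "Pow {1..j}"]) (auto simp: difference_avoiding_def)

lemma tiling_of_restricted_overlap:
  assumes "finite Q" "Q \<noteq> {}" "0 \<notin> Q"
    and C: "C \<in> difference_avoiding Q (int N - int (Max Q)) k"
  shows "restricted_overlap_tiling Q N (tiling_of Q N C)"
    and "int (card {t \<in> tiling_of Q N C. fst t = Comb}) = k"
proof -
  have sub: "1 \<le> x \<and> x + int (Max Q) \<le> int N" if "x \<in> C" for x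
    using C that by (force simp: difference_avoiding_def)
  have avoid: "y - x \<notin> int ` Q" if "x \<in> C" "y \<in> C" for x y
    using C that by (auto simp: difference_avoiding_def)
  have le: "i \<le> Max Q" if "i \<in> comb Q" for i
    using that assms(1) by (auto simp: comb_def)
  have board: "covered Q t \<subseteq> {1..N}" if t: "t \<in> tiling_of Q N C" for t
  proof -
    consider x where "t = (Comb, nat x)" "x \<in> C" | x where "t = (Square, x)" "x \<in> {1..N}"
      using t by (auto simp: tiling_of_def)
    then show ?thesis
    proof cases
      case 1
      then show ?thesis using sub[of x] le by fastforce
    qed auto
  qed
  have cover: "{1..N} \<subseteq> (\<Union>t\<in>tiling_of Q N C. covered Q t)"
  proof
    fix x assume x: "x \<in> {1..N}"
    show "x \<in> (\<Union>t\<in>tiling_of Q N C. covered Q t)"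
    proof (cases "x \<in> (\<Union>x\<in>C. covered Q (Comb, nat x))")
      case True
      then show ?thesis unfolding tiling_of_def by blast
    next
      case False
      then have "(Square, x) \<in> tiling_of Q N C" using x by (auto simp: tiling_of_def)
      then show ?thesis by force
    qed
  qed
  \<comment> \<open>If \<open>t'\<close> is a square, \<open>t\<close> must be a comb starting on
    the same cell, which is then not free for a square. If \<open>t'\<close> is a comb,
    \<open>t\<close> cannot be a square, and two combs would start at a difference in
    \<open>Q\<close>.\<close>
  have disj: "snd t \<notin> covered Q t'"
    if t: "t \<in> tiling_of Q N C" and t': "t' \<in> tiling_of Q N C" and ne: "t' \<noteq> t" for t t'
  proof
    assume s: "snd t \<in> covered Q t'"
    show False
    proof (cases "fst t'")
      case Square
      then have "snd t = snd t'" using s by (cases t') auto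
      moreover have "fst t = Comb"
        using ne Square calculation by (cases t, cases t', cases "fst t") auto
      ultimately obtain x where x: "x \<in> C" "t = (Comb, nat x)" "snd t' = nat x"
        using t by (auto simp: tiling_of_def)
      have "nat x \<in> covered Q (Comb, nat x)" by (force simp: comb_def)
      then show False using t' x Square by (auto simp: tiling_of_def)
    next
      case Comb
      then obtain x where x: "x \<in> C" "t' = (Comb, nat x)" using t' by (auto simp: tiling_of_def)
      then have "fst t \<noteq> Square" using s t by (auto simp: tiling_of_def)
      then obtain y where y: "y \<in> C" "t = (Comb, nat y)" using t by (auto simp: tiling_of_def)
      then obtain i where i: "i \<in> comb Q" "nat y = nat x + i" using s x by auto
      have "y - x = int i" using sub[of x] sub[of y] x y i by linarith
      moreover have "i \<noteq> 0" using i ne x y by auto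
      ultimately show False using avoid[of x y] x y i by (auto simp: comb_def)
    qed
  qed
  show "restricted_overlap_tiling Q N (tiling_of Q N C)"
    unfolding restricted_overlap_tiling_def using board cover disj by blast
  have "{t \<in> tiling_of Q N C. fst t = Comb} = (\<lambda>x. (Comb, nat x)) ` C"
    by (auto simp: tiling_of_def)
  moreover have "inj_on (\<lambda>x. (Comb, nat x)) C"
    using sub by (intro inj_onI) fastforce
  ultimately show "int (card {t \<in> tiling_of Q N C. fst t = Comb}) = k"
    using C by (simp add: card_image difference_avoiding_def)
qed

text \<open>The condition on leftmost cells acts twice: between two combs it forbids differences in
  \<open>Q\<close>, and between a square and a comb it keeps the square off the comb. Coverage then
  puts a square on every remaining cell.\<close>

lemma restricted_overlap_tiling_obtain:
  assumes "finite Q" "Q \<noteq> {}" "0 \<notin> Q"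
    and T: "restricted_overlap_tiling Q N T" and k: "int (card {t \<in> T. fst t = Comb}) = k"
  obtains C where "C \<in> difference_avoiding Q (int N - int (Max Q)) k" "T = tiling_of Q N C"
proof
  let ?C = "int ` {x. (Comb, x) \<in> T}"
  have board: "covered Q t \<subseteq> {1..N}" if "t \<in> T" for t
    using T that by (auto simp: restricted_overlap_tiling_def)
  have cover: "\<exists>t\<in>T. x \<in> covered Q t" if "x \<in> {1..N}" for x
    using T that by (auto simp: restricted_overlap_tiling_def)
  have disj: "t' = t" if "t \<in> T" "t' \<in> T" "snd t \<in> covered Q t'" for t t'
    using T that by (auto simp: restricted_overlap_tiling_def)
  have "{t \<in> T. fst t = Comb} = Pair Comb ` {x. (Comb, x) \<in> T}" by force
  then have card: "int (card ?C) = k" using k by (simp add: card_image inj_on_def)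
  have "x \<ge> 1 \<and> x + Max Q \<le> N" if "(Comb, x) \<in> T" for x
  proof -
    \<comment> \<open>Both end cells of the comb are filled, and their lying on the board gives the
      two bounds on its position.\<close>
    have "Max Q \<in> comb Q" "0 \<in> comb Q" using assms(1,2) by (auto simp: comb_def)
    then have "x + 0 \<in> {1..N}" "x + Max Q \<in> {1..N}" using board[OF that] by auto
    then show ?thesis by auto
  qed
  then have sub: "?C \<subseteq> {1..int N - int (Max Q)}" by fastforce
  have "int y - int x \<notin> int ` Q" if "(Comb, x) \<in> T" "(Comb, y) \<in> T" for x y
  proof
    assume "int y - int x \<in> int ` Q"
    then obtain i where i: "i \<in> Q" "y = x + i" by force
    then have "y \<in> covered Q (Comb, x)" by (auto simp: comb_def)
    then have "x = y" using disj[OF that(2,1)] by auto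
    then show False using i assms(3) by auto
  qed
  then show "?C \<in> difference_avoiding Q (int N - int (Max Q)) k"
    using sub card by (auto simp: difference_avoiding_def)
  show "T = tiling_of Q N ?C"
  proof (rule set_eqI)
    fix t :: placed_tile
    obtain u x where t: "t = (u, x)" by (cases t)
    show "t \<in> T \<longleftrightarrow> t \<in> tiling_of Q N ?C"
    proof (cases u)
      case Comb
      then show ?thesis by (auto simp: t tiling_of_def image_iff)
    next
      case Square
      have "(Square, x) \<in> T \<longleftrightarrow> x \<in> {1..N} \<and> (\<forall>y. (Comb, y) \<in> T \<longrightarrow> x \<notin> covered Q (Comb, y))"
      proof
        assume "(Square, x) \<in> T"
        then show "x \<in> {1..N} \<and> (\<forall>y. (Comb, y) \<in> T \<longrightarrow> x \<notin> covered Q (Comb, y))"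
          using board[of "(Square, x)"] disj[of "(Square, x)"] by (auto simp del: covered.simps(2))
      next
        assume x: "x \<in> {1..N} \<and> (\<forall>y. (Comb, y) \<in> T \<longrightarrow> x \<notin> covered Q (Comb, y))"
        then obtain t' where t': "t' \<in> T" "x \<in> covered Q t'" using cover by blast
        then have "fst t' = Square" using x by (cases t', cases "fst t'") (auto simp del: covered.simps)
        then show "(Square, x) \<in> T" using t' by (cases t') auto
      qed
      then show ?thesis using Square by (auto simp: t tiling_of_def simp del: covered.simps(2))
    qed
  qed
qed

lemma inj_on_tiling_of: "inj_on (tiling_of Q N) (difference_avoiding Q j k)"
proof (rule inj_on_inverseI)
  fix C assume "C \<in> difference_avoiding Q j k"
  then have "x \<ge> 1" if "x \<in> C" for x
    using that by (auto simp: difference_avoiding_def)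
  then have "int (nat x) = x" if "x \<in> C" for x
    using that by force
  moreover have "{x. (Comb, x) \<in> tiling_of Q N C} = nat ` C"
    by (auto simp: tiling_of_def)
  ultimately show "int ` {x. (Comb, x) \<in> tiling_of Q N C} = C"
    by (simp add: image_image)
qed

text \<open>Of the conventions in \<open>B\<close>, only \<open>n < 0\<close> needs a case: for
  \<open>n >= 0\<close> with \<open>k < 0\<close> or \<open>n < k\<close> the count is zero anyway,
  since a subset of \<open>{1..n - Max Q}\<close> has at most \<open>n\<close> elements. For
  negative \<open>n\<close> and \<open>k = 0\<close> the empty set would wrongly be counted.\<close>

lemma B_eq_card_difference_avoiding:
  assumes "finite Q" "Q \<noteq> {}" "0 \<notin> Q"
  shows "B Q n k = (if n < 0 then 0 else int (card (difference_avoiding Q (n - int (Max Q)) k)))"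
proof -
  have empty: "difference_avoiding Q (n - int (Max Q)) k = {}" if "n \<ge> 0" "k < 0 \<or> n < k"
  proof -
    have "int (card C) \<le> n" if "C \<subseteq> {1..n - int (Max Q)}" for C
      using card_mono[OF _ that] \<open>n \<ge> 0\<close> by simp
    then show ?thesis using that by (fastforce simp: difference_avoiding_def)
  qed
  show ?thesis
  proof (cases "n < 0 \<or> k < 0 \<or> n < k")
    case True
    then show ?thesis using empty by (auto simp: B_def)
  next
    case False
    have "{T. restricted_overlap_tiling Q (nat n) T \<and> card {t \<in> T. fst t = Comb} = nat k}
        = tiling_of Q (nat n) ` difference_avoiding Q (n - int (Max Q)) k" (is "?L = ?R")
    proof
      show "?L \<subseteq> ?R"
        using restricted_overlap_tiling_obtain[OF assms, of "nat n" _ k] False by fastforce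
      show "?R \<subseteq> ?L"
        using tiling_of_restricted_overlap[OF assms, of _ "nat n" k] False by fastforce
    qed
    then show ?thesis using False by (auto simp: B_def card_image inj_on_tiling_of)
  qed
qed

section \<open>Counting difference-avoiding sets by their last gap\<close>

text \<open>The common core of both alternatives in the theorem, read as rules on gaps: none is
  below \<open>l\<close>; \<open>l\<close> is allowed, but not twice in a row; any other allowed gap
  up to \<open>Max Q\<close> exceeds \<open>Max Q\<close> once a neighbouring gap, itself at least
  \<open>l\<close>, is added.\<close>

locale isolated_min_gap =
  fixes Q :: "nat set" and l :: nat
  assumes finite: "finite Q" and zero_notin: "0 \<notin> Q" and l_pos: "0 < l"
    and below: "{1..<l} \<subseteq> Q" and l_notin: "l \<notin> Q" and double: "2 * l \<in> Q"
    and above: "\<And>x. x \<in> {1..Max Q} - Q - {l} \<Longrightarrow> Max Q < x + l"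
begin

abbreviation "V \<equiv> difference_avoiding Q"

definition with_end :: "int \<Rightarrow> int \<Rightarrow> int set set" where
  "with_end j k = {C \<in> V j k. j \<in> C}"

text \<open>Since \<open>2 * l\<close> is a forbidden difference, exactly these sets may be followed
  by a gap \<open>l\<close>.\<close>

definition with_end_not_l :: "int \<Rightarrow> int \<Rightarrow> int set set" where
  "with_end_not_l j k = {C \<in> with_end j k. j - int l \<notin> C}"

lemma V_D:
  assumes "C \<in> V j k"
  shows "C \<subseteq> {1..j}" "finite C" "int (card C) = k"
    and "\<And>x y. x \<in> C \<Longrightarrow> y \<in> C \<Longrightarrow> y - x \<notin> int ` Q"
  using assms finite_subset[of C "{1..j}"] by (auto simp: difference_avoiding_def)

lemma finite_with_end: "finite (with_end j k)" "finite (with_end_not_l j k)"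
  by (auto simp: with_end_def with_end_not_l_def finite_difference_avoiding)

lemma Q_le: "i \<in> Q \<Longrightarrow> i \<le> Max Q"
  using finite by simp

lemma card_with_end: "int (card (with_end j k)) = int (card (V j k)) - int (card (V (j - 1) k))"
proof -
  have "V j k = V (j - 1) k \<union> with_end j k" (is "_ = ?R")
  proof
    show "V j k \<subseteq> ?R"
    proof
      fix C assume C: "C \<in> V j k"
      have "C \<subseteq> {1..j - 1}" if "j \<notin> C"
      proof
        fix x assume "x \<in> C"
        then show "x \<in> {1..j - 1}" using V_D(1)[OF C] that by (cases "x = j") auto
      qed
      then show "C \<in> ?R" using C by (auto simp: with_end_def difference_avoiding_def)
    qed
  qed (auto simp: with_end_def difference_avoiding_def)
  moreover have "V (j - 1) k \<inter> with_end j k = {}"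
    by (auto simp: with_end_def difference_avoiding_def)
  ultimately show ?thesis
    by (simp add: card_Un_disjoint finite_difference_avoiding finite_with_end)
qed

text \<open>Differences inside \<open>D\<close> are already fine and those from \<open>j\<close>
  back to \<open>D\<close> are negative, so only \<open>j - y\<close> has to be checked.\<close>

lemma insert_in_with_end:
  assumes D: "D \<in> V i (k - 1)" and "i < j" "1 \<le> j"
    and diff: "\<And>y. y \<in> D \<Longrightarrow> j - y \<notin> int ` Q"
  shows "insert j D \<in> with_end j k"
proof -
  note D' = V_D[OF D]
  have "j \<notin> D" using D'(1) assms by auto
  then have "int (card (insert j D)) = k" using D' by simp
  moreover have "insert j D \<subseteq> {1..j}" using D'(1) assms by auto
  moreover have "y - j \<notin> int ` Q" if "y \<in> D" for y
    using D'(1) that assms(2) by auto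
  ultimately show ?thesis
    using D'(4) diff zero_notin by (auto simp: with_end_def difference_avoiding_def)
qed

lemma remove_end:
  assumes "C \<in> with_end j k" and "C - {j} \<subseteq> {1..i}"
  shows "C - {j} \<in> V i (k - 1)"
proof -
  have C: "C \<in> V j k" "j \<in> C" using assms by (auto simp: with_end_def)
  have "int (card (C - {j})) = k - 1"
    using V_D(2,3)[OF C(1)] C(2) by (metis card.remove of_nat_Suc add_diff_cancel_left')
  then show ?thesis using V_D(4)[OF C(1)] assms(2) by (auto simp: difference_avoiding_def)
qed

lemma with_end_diff:
  assumes "C \<in> with_end j k" "y \<in> C" "y \<noteq> j" "y \<ge> j - int (Max Q)"
  shows "nat (j - y) \<in> {1..Max Q} - Q" "int (nat (j - y)) = j - y"
proof -
  have C: "C \<in> V j k" "j \<in> C" using assms by (auto simp: with_end_def)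
  have y: "y < j" using V_D(1)[OF C(1)] assms by force
  have "nat (j - y) \<notin> Q"
  proof
    assume "nat (j - y) \<in> Q"
    then have "int (nat (j - y)) \<in> int ` Q" by blast
    then show False using V_D(4)[OF C(1), of y j] assms C y by simp
  qed
  then show "nat (j - y) \<in> {1..Max Q} - Q" "int (nat (j - y)) = j - y"
    using y assms by auto
qed

lemma diff_ge_l:
  assumes "C \<in> with_end j k" "y \<in> C" "y \<noteq> j"
  shows "y \<le> j - int l"
proof (rule ccontr)
  assume y: "\<not> ?thesis"
  have "l \<le> Max Q" using Q_le[OF double] by simp
  then have "nat (j - y) \<notin> Q" "nat (j - y) \<ge> 1" "int (nat (j - y)) = j - y"
    using with_end_diff[OF assms] y by auto
  then have "nat (j - y) \<in> {1..<l}" using y by simp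
  then show False using below \<open>nat (j - y) \<notin> Q\<close> by blast
qed

lemma greater_Max_notin: "x > int (Max Q) \<Longrightarrow> x \<notin> int ` Q"
  using Q_le by fastforce

text \<open>Removing \<open>j\<close> leaves a set ending at \<open>j - l\<close>, whose own last
  gap cannot be \<open>l\<close> because \<open>2 * l\<close> is in \<open>Q\<close>. Conversely, if
  that gap is not \<open>l\<close>, all earlier elements are more than \<open>Max Q\<close> away
  from \<open>j\<close>.\<close>

lemma with_end_via_l:
  "{C \<in> with_end j k. j - int l \<in> C} = insert j ` with_end_not_l (j - int l) (k - 1)"
    (is "?L = ?R")
proof
  show "?L \<subseteq> ?R"
  proof
    fix C assume "C \<in> ?L"
    then have C: "C \<in> with_end j k" "j - int l \<in> C" by auto
    have sub: "C \<subseteq> {1..j}" "j \<in> C" using C V_D(1) by (auto simp: with_end_def)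
    then have "C - {j} \<subseteq> {1..j - int l}" using diff_ge_l[OF C(1)] by fastforce
    from remove_end[OF C(1) this] have "C - {j} \<in> with_end (j - int l) (k - 1)"
      using C l_pos by (auto simp: with_end_def)
    moreover have "j - int l - int l \<notin> C"
    proof
      assume "j - int l - int l \<in> C"
      then have "j - (j - int l - int l) \<notin> int ` Q"
        using V_D(4)[of C j k "j - int l - int l" j] C by (simp add: with_end_def)
      moreover have "j - (j - int l - int l) = int (2 * l)" by simp
      ultimately show False using double by blast
    qed
    ultimately have "C - {j} \<in> with_end_not_l (j - int l) (k - 1)"
      by (auto simp: with_end_not_l_def)
    moreover have "C = insert j (C - {j})" using sub by auto
    ultimately show "C \<in> ?R" by blast
  qed
  show "?R \<subseteq> ?L"
  proof
    fix C assume "C \<in> ?R"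
    then obtain D where D: "D \<in> with_end_not_l (j - int l) (k - 1)" "C = insert j D" by auto
    then have D': "D \<in> with_end (j - int l) (k - 1)" "D \<in> V (j - int l) (k - 1)"
      "j - int l \<in> D" "j - int l - int l \<notin> D"
      by (auto simp: with_end_def with_end_not_l_def)
    have "j - y \<notin> int ` Q" if y: "y \<in> D" for y
    proof (cases "y = j - int l")
      case True
      then show ?thesis using l_notin by auto
    next
      case False
      \<comment> \<open>The distance from \<open>y\<close> to \<open>j - l\<close> either exceeds
        \<open>Max Q\<close> already or is an allowed gap other than \<open>l\<close>, to which
        \<open>above\<close> applies.\<close>
      have "j - y > int (Max Q)"
      proof (cases "y \<ge> j - int l - int (Max Q)")
        case True
        note d = with_end_diff[OF D'(1) y False True]
        have "nat (j - int l - y) \<noteq> l" 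
        proof
          assume "nat (j - int l - y) = l"
          then have "y = j - int l - int l" using d by linarith
          then show False using D'(4) y by simp
        qed
        then have "Max Q < nat (j - int l - y) + l" using above d by auto
        then show ?thesis using d by linarith
      qed simp
      then show ?thesis by (rule greater_Max_notin)
    qed
    moreover have "1 \<le> j" using V_D(1)[OF D'(2)] D'(3) by auto
    ultimately have "C \<in> with_end j k"
      using insert_in_with_end[OF D'(2), of j] l_pos D(2) by auto
    then show "C \<in> ?L" using D D' by auto
  qed
qed

lemma inj_on_insert_V: "i < j \<Longrightarrow> inj_on (insert j) (V i k)"
  by (rule inj_on_inverseI[where g = "\<lambda>C. C - {j}"]) (auto simp: difference_avoiding_def)

lemma card_with_end_split:
  "card (with_end j k) = card (with_end_not_l j k) + card (with_end_not_l (j - int l) (k - 1))"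
proof -
  have "with_end j k = with_end_not_l j k \<union> insert j ` with_end_not_l (j - int l) (k - 1)"
    unfolding with_end_via_l[symmetric] by (auto simp: with_end_not_l_def)
  moreover have "with_end_not_l j k \<inter> insert j ` with_end_not_l (j - int l) (k - 1) = {}"
    unfolding with_end_via_l[symmetric] by (auto simp: with_end_not_l_def)
  moreover have "inj_on (insert j) (with_end_not_l (j - int l) (k - 1))"
    by (rule inj_on_subset[OF inj_on_insert_V[of "j - int l" j "k - 1"]])
      (use l_pos in \<open>auto simp: with_end_not_l_def with_end_def\<close>)
  ultimately show ?thesis
    by (simp add: card_Un_disjoint finite_with_end card_image)
qed

abbreviation "P \<equiv> {1..Max Q} - Q - {l}"

lemma P_gt_l: "x \<in> P \<Longrightarrow> l < x"
proof -
  assume x: "x \<in> P"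
  then have "\<not> x < l" using below by auto
  then show ?thesis using x by auto
qed

text \<open>If \<open>j\<close> is alone or the last gap exceeds \<open>Max Q\<close>, the rest is
  an arbitrary set up to \<open>j - Max Q - 1\<close>. If the last gap is some \<open>x\<close> in
  \<open>P\<close>, the rest ends at \<open>j - x\<close> and is otherwise arbitrary, as one more
  gap brings the distance to \<open>j\<close> above \<open>Max Q\<close>. For \<open>j <= 0\<close>
  and \<open>k = 1\<close> the equation fails: only the right side contains
  \<open>{j}\<close>.\<close>

lemma with_end_not_l_eq:
  assumes "1 \<le> j"
  shows "with_end_not_l j k =
    insert j ` V (j - int (Max Q) - 1) (k - 1) \<union> (\<Union>x\<in>P. insert j ` with_end (j - int x) (k - 1))"
    (is "?L = ?R")
proof
  show "?L \<subseteq> ?R"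
  proof
    fix C assume "C \<in> ?L"
    then have C: "C \<in> with_end j k" "j - int l \<notin> C" by (auto simp: with_end_not_l_def)
    then have CV: "C \<in> V j k" and j: "j \<in> C" by (auto simp: with_end_def)
    have ins: "C = insert j (C - {j})" using j by auto
    show "C \<in> ?R"
    proof (cases "C - {j} \<subseteq> {1..j - int (Max Q) - 1}")
      case True
      from remove_end[OF C(1) True] show ?thesis using ins by blast
    next
      case False
      \<comment> \<open>The second largest element of \<open>C\<close>, so that \<open>j - y\<close>
        is the last gap.\<close>
      define y where "y = Max (C - {j})"
      have fin: "finite (C - {j})" using V_D(2)[OF CV] by simp
      obtain z where z: "z \<in> C - {j}" "z \<notin> {1..j - int (Max Q) - 1}" using False by blast
      then have y: "y \<in> C - {j}" using fin Max_in[of "C - {j}"] unfolding y_def by blast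
      have max: "w \<le> y" if "w \<in> C - {j}" for w using fin that unfolding y_def by simp
      have "z \<ge> j - int (Max Q)" using z V_D(1)[OF CV] by auto
      then have yge: "y \<ge> j - int (Max Q)" using max z by force
      note d = with_end_diff[OF C(1) _ _ yge]
      have x: "nat (j - y) \<in> P" "j - int (nat (j - y)) = y" using d y C(2) by auto
      have "C - {j} \<subseteq> {1..y}" using V_D(1)[OF CV] max by fastforce
      from remove_end[OF C(1) this] have "C - {j} \<in> with_end (j - int (nat (j - y))) (k - 1)"
        using y x by (simp add: with_end_def)
      then show ?thesis using ins x(1) by blast
    qed
  qed
  show "?R \<subseteq> ?L"
  proof
    fix C assume "C \<in> ?R"
    then consider D where "D \<in> V (j - int (Max Q) - 1) (k - 1)" "C = insert j D"
      | x D where "x \<in> P" "D \<in> with_end (j - int x) (k - 1)" "C = insert j D"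
      by blast
    then show "C \<in> ?L"
    proof cases
      case 1
      have sub: "y < j - int (Max Q)" if "y \<in> D" for y using V_D(1)[OF 1(1)] that by auto
      then have "C \<in> with_end j k"
        using insert_in_with_end[OF 1(1), of j] 1(2) assms greater_Max_notin by force
      moreover have "j - int l \<notin> D" using sub Q_le[OF double] by force
      ultimately show ?thesis using 1(2) l_pos by (auto simp: with_end_not_l_def)
    next
      case 2
      then have D: "D \<in> V (j - int x) (k - 1)" by (simp add: with_end_def)
      have "j - y \<notin> int ` Q" if y: "y \<in> D" for y
      proof (cases "y = j - int x")
        case True
        then show ?thesis using 2 by auto
      next
        case False
        then have "y \<le> j - int x - int l" using diff_ge_l[OF 2(2) y] by simp
        then show ?thesis using above[OF 2(1)] by (intro greater_Max_notin) linarith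
      qed
      then have "C \<in> with_end j k"
        using insert_in_with_end[OF D, of j] 2 assms by auto
      moreover have "j - int l \<notin> D" using V_D(1)[OF D] P_gt_l[OF 2(1)] by auto
      ultimately show ?thesis using 2(3) l_pos by (auto simp: with_end_not_l_def)
    qed
  qed
qed

text \<open>The pieces are disjoint because the second largest element tells them apart: it is
  \<open>j - x\<close> in \<open>?E x\<close>, and below \<open>j - Max Q\<close>, if it exists, in
  \<open>?A\<close>.\<close>

lemma card_with_end_not_l:
  assumes "1 \<le> j"
  shows "card (with_end_not_l j k) =
    card (V (j - int (Max Q) - 1) (k - 1)) + (\<Sum>x\<in>P. card (with_end (j - int x) (k - 1)))"
proof -
  let ?A = "insert j ` V (j - int (Max Q) - 1) (k - 1)"
  let ?E = "\<lambda>x. insert j ` with_end (j - int x) (k - 1)"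
  have inE: "j - int x \<in> C \<and> (\<forall>y\<in>C. y \<noteq> j \<longrightarrow> y \<le> j - int x)" if "C \<in> ?E x" for x C
    using that by (auto simp: with_end_def dest!: V_D(1))
  have inA: "y < j - int (Max Q)" if "C \<in> ?A" "y \<in> C" "y \<noteq> j" for y C
    using that by (auto dest!: V_D(1))
  have "?A \<inter> (\<Union>x\<in>P. ?E x) = {}"
  proof (rule ccontr)
    assume "?A \<inter> (\<Union>x\<in>P. ?E x) \<noteq> {}"
    then obtain C x where "C \<in> ?A" "x \<in> P" "C \<in> ?E x" by blast
    then show False using inA[of C "j - int x"] inE[of C x] by auto
  qed
  moreover have "?E x \<inter> ?E y = {}" if xy: "x \<in> P" "y \<in> P" "x \<noteq> y" for x y
  proof (rule ccontr)
    assume "?E x \<inter> ?E y \<noteq> {}"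
    then obtain C where C: "C \<in> ?E x" "C \<in> ?E y" by blast
    have "j - int x \<noteq> j" "j - int y \<noteq> j" using xy by auto
    then have "j - int x \<le> j - int y" "j - int y \<le> j - int x"
      using inE[OF C(1)] inE[OF C(2)] by blast+
    then show False using xy by simp
  qed
  then have "card (\<Union>x\<in>P. ?E x) = (\<Sum>x\<in>P. card (?E x))"
    by (intro card_UN_disjoint) (auto simp: finite_with_end)
  moreover have "card (?E x) = card (with_end (j - int x) (k - 1))" if "x \<in> P" for x
    by (intro card_image inj_on_subset[OF inj_on_insert_V[of "j - int x" j "k - 1"]])
      (use that in \<open>auto simp: with_end_def\<close>)
  moreover have "card ?A = card (V (j - int (Max Q) - 1) (k - 1))"
    by (intro card_image inj_on_insert_V) simp
  ultimately show ?thesis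
    unfolding with_end_not_l_eq[OF assms]
    by (simp add: card_Un_disjoint finite_with_end finite_difference_avoiding)
qed

section \<open>From set counts to the recursion for \<open>B\<close>\<close>

lemma with_end_nonpos: "j \<le> 0 \<Longrightarrow> with_end j k = {}"
  by (auto simp: with_end_def difference_avoiding_def)

lemma B_eq: "B Q n k = (if n < 0 then 0 else int (card (V (n - int (Max Q)) k)))"
  using B_eq_card_difference_avoiding finite double zero_notin by blast

text \<open>The delta term pays for the convention at negative length: at \<open>n = 0\<close> and
  \<open>k = 0\<close> the empty set is counted for both bounds, but \<open>B Q (-1) 0\<close> is
  set to 0.\<close>

lemma B_diff_eq:
  "B Q n k - B Q (n - 1) k = int (card (with_end (n - int (Max Q)) k)) + kdelta n 0 * kdelta k 0"
proof (cases "n = 0")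
  case True
  have "V (- int (Max Q)) k = (if k = 0 then {{}} else {})"
    by (auto simp: difference_avoiding_def)
  then show ?thesis using True by (simp add: B_eq kdelta_def with_end_nonpos)
next
  case False
  then show ?thesis
    using card_with_end[of "n - int (Max Q)" k]
    by (auto simp: B_eq kdelta_def with_end_nonpos algebra_simps)
qed

lemma card_with_end_not_l_eq_B:
  "int (card (with_end_not_l (n - int (Max Q)) k)) = B Q (n - int (Max Q) - 1) (k - 1)
    + (\<Sum>x\<in>P. B Q (n - int x) (k - 1) - B Q (n - int x - 1) (k - 1)
        - kdelta n (int x) * kdelta k 1)"
proof -
  \<comment> \<open>Each summand is an increment of \<open>B\<close> at \<open>n - x\<close> and
    \<open>k - 1\<close>, corrected by the delta term of \<open>B_diff_eq\<close>.\<close>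
  have *: "B Q (n - int x) (k - 1) - B Q (n - int x - 1) (k - 1) - kdelta n (int x) * kdelta k 1
      = int (card (with_end (n - int (Max Q) - int x) (k - 1)))" for x
    using B_diff_eq[of "n - int x" "k - 1"] by (simp add: kdelta_def algebra_simps)
  show ?thesis
  proof (cases "n - int (Max Q) \<ge> 1")
    case True
    then show ?thesis
      unfolding * by (simp add: card_with_end_not_l B_eq diff_right_commute[of _ _ 1])
  next
    \<comment> \<open>Both sides vanish here: every \<open>with_end\<close> set family is empty, and
      the leading \<open>B\<close> has a negative length.\<close>
    case False
    then show ?thesis
      unfolding * by (simp add: with_end_not_l_def with_end_nonpos B_eq)
  qed
qed

text \<open>The increment of \<open>B\<close> splits by whether the last gap is \<open>l\<close>.
  The sets whose last gap is not \<open>l\<close> give the terms in \<open>k - 1\<close>; the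
  others, after removal of the largest element, give the same expression with \<open>n\<close>
  lowered by \<open>l\<close> and \<open>k\<close> by 1.\<close>

lemma B_recursion:
  "B Q n k = kdelta n 0 * kdelta k 0 + B Q (n - 1) k
      + B Q (n - int (Max Q) - 1) (k - 1) + B Q (n - int l - int (Max Q) - 1) (k - 2)
      + (\<Sum>x\<in>P.
           B Q (n - int x) (k - 1) - B Q (n - int x - 1) (k - 1)
           + B Q (n - int l - int x) (k - 2) - B Q (n - int l - int x - 1) (k - 2)
           - kdelta n (int x) * kdelta k 1
           - kdelta n (int l + int x) * kdelta k 2)"
proof -
  have "kdelta (n - int l) (int x) * kdelta (k - 1) 1 = kdelta n (int l + int x) * kdelta k 2" for x
    by (auto simp: kdelta_def)
  then have "int (card (with_end_not_l (n - int (Max Q) - int l) (k - 1))) =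
      B Q (n - int l - int (Max Q) - 1) (k - 2)
      + (\<Sum>x\<in>P. B Q (n - int l - int x) (k - 2) - B Q (n - int l - int x - 1) (k - 2)
          - kdelta n (int l + int x) * kdelta k 2)"
    using card_with_end_not_l_eq_B[of "n - int l" "k - 1"] by (simp add: diff_right_commute)
  then show ?thesis
    using B_diff_eq[of n k] card_with_end_split[of "n - int (Max Q)" k] card_with_end_not_l_eq_B[of n k]
    by (simp add: sum.distrib sum_subtractf)
qed

end

section \<open>The hypotheses of the theorem yield the gap rules\<close>

theorem theorem8:
  fixes Q :: "nat set" and q a l r :: nat and p :: "nat \<Rightarrow> nat" and n k :: int
  assumes "finite Q" and "Q \<noteq> {}" and "0 \<notin> Q"
    and "q = Max Q"
    and "a = card ({1..q} - Q)" and "a \<ge> 1"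
    and "strict_mono_on {1..a} p" and "p ` {1..a} = {1..q} - Q"
    and "l = first_tooth_width Q" and "r = final_tooth_width Q"
    and "p 1 = l" and "p a = q - r" and "l > r"
    and "q = 2 * l \<or> (a = 2 \<and> q \<ge> 2 * l \<and> q \<noteq> 2 * l + r)"
  shows "B Q n k =
      kdelta n 0 * kdelta k 0 + B Q (n - 1) k
      + B Q (n - int q - 1) (k - 1) + B Q (n - int l - int q - 1) (k - 2)
      + (\<Sum>i = 2..a.
           B Q (n - int (p i)) (k - 1) - B Q (n - int (p i) - 1) (k - 1)
           + B Q (n - int l - int (p i)) (k - 2) - B Q (n - int l - int (p i) - 1) (k - 2)
           - kdelta n (int (p i)) * kdelta k 1
           - kdelta n (int l + int (p i)) * kdelta k 2)"
proof -
  have q_in: "q \<in> Q" using assms(1,2,4) by simp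
  have mono: "p i < p j" if "i \<in> {1..a}" "j \<in> {1..a}" "i < j" for i j
    using assms(7) that by (auto simp: strict_mono_on_def)
  have l: "l \<in> {1..q} - Q" using assms(6,8,11) by force
  have ge: "l < p i" if "i \<in> {2..a}" for i
    using mono[of 1 i] that assms(6,11) by auto
  have split: "{1..a} = insert 1 {2..a}" using assms(6) by auto
  have P: "{1..Max Q} - Q - {l} = p ` {2..a}"
  proof -
    have "{1..q} - Q = insert l (p ` {2..a})"
      using assms(8,11) unfolding split by simp
    moreover have "l \<notin> p ` {2..a}" using ge by fastforce
    ultimately show ?thesis using assms(4) by auto
  qed
  have inj: "inj_on p {2..a}"
  proof (rule inj_onI)
    fix i j assume "i \<in> {2..a}" "j \<in> {2..a}" "p i = p j"
    then show "i = j" using mono[of i j] mono[of j i] by (cases i j rule: linorder_cases) auto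
  qed
  interpret isolated_min_gap Q l
  proof
    show "finite Q" "0 \<notin> Q" by fact+
    show "0 < l" "l \<notin> Q" using l by auto
    show "{1..<l} \<subseteq> Q"
    proof
      fix x assume x: "x \<in> {1..<l}"
      \<comment> \<open>As \<open>p\<close> increases from \<open>p 1 = l\<close>, no number below
        \<open>l\<close> is a value of \<open>p\<close>.\<close>
      have "x \<notin> insert l (p ` {2..a})" using x ge by force
      then have "x \<notin> {1..q} - Q" using P assms(4) x by auto
      then show "x \<in> Q" using x l by auto
    qed
    show "2 * l \<in> Q"
      using assms(14)
    proof
      assume "q = 2 * l"
      then show ?thesis using q_in by simp
    next
      assume a: "a = 2 \<and> q \<ge> 2 * l \<and> q \<noteq> 2 * l + r"
      \<comment> \<open>The only value left is \<open>p 2 = q - r\<close>, and this differs from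
        \<open>2 * l\<close> because \<open>q\<close> is not \<open>2 * l + r\<close>.\<close>
      then have "2 * l \<notin> p ` {2..a}" using assms(12,13) by auto
      then have "2 * l \<notin> {1..Max Q} - Q - {l}" using P by simp
      then show ?thesis using a l assms(4) by auto
    qed
    show "Max Q < x + l" if x: "x \<in> {1..Max Q} - Q - {l}" for x
    proof -
      obtain i where i: "i \<in> {2..a}" "x = p i" using x unfolding P by blast
      \<comment> \<open>In the first case \<open>x > l\<close> and \<open>q = 2 * l\<close>; in the
        second \<open>x = q - r\<close> and \<open>l > r\<close>.\<close>
      from assms(14) show ?thesis
      proof
        assume "q = 2 * l"
        then show ?thesis using ge[OF i(1)] i(2) assms(4) by simp
      next
        assume "a = 2 \<and> q \<ge> 2 * l \<and> q \<noteq> 2 * l + r"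
        then show ?thesis using i assms(4,12,13) by auto
      qed
    qed
  qed
  show ?thesis
    using B_recursion[of n k] unfolding P sum.reindex[OF inj] by (simp add: assms(4))
qed

end
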